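(* Let $n$ be a positive integer and let $X_1,\ldots,X_n$ be independent random variables such that $0\le X_i\le 1$ for each $i=1,\ldots,n$. Set $p=\frac1n\sum_{i=1}^n\mathbb{E}[X_i]$. Then, for any fixed positive integer $t$ such that $np<t<n$, we have $$\mathbb{P}\left[\sum_{i=1}^n X_i\ge t\right]\le\frac{t-tp}{t-np}\cdot\mathbb{P}[B\ge t],$$ where $B\sim\mathrm{Bin}(n,p)$ is a binomial random variable.
   Context: $\mathrm{Bin}(n,p)$ is the binomial distribution with parameters $n$ and $p$. *)

theory Defs
  imports "HOL-Probability.Probability"
begin

end

theory Submission
  imports Defs
begin

text \<open>
  The proof follows the method of Bernstein and Hoeffding, but with a piecewise linear test
  function in place of an exponential. If \<open>\<phi>\<close> is convex and dominates the indicator of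
  \<open>[t, \<infinity>)\<close>, then \<open>\<P>[\<Sum> X\<^sub>i \<ge> t] \<le> \<E> \<phi> (\<Sum> X\<^sub>i) \<le> \<E> \<phi> B\<close>, where the second step is Hoeffding's
  comparison of a sum of independent \<open>[0,1]\<close>-valued variables with a binomial variable.
  The theorem is the case \<open>\<phi> y = max 0 (y - t + 1)\<close>, whose values at the integers are
  the smallest among convex functions that vanish at every integer below \<open>t\<close> and equal \<open>1\<close> at \<open>t\<close>.

  Hoeffding's comparison runs through the function \<open>bernoulli_mix f x I\<close>, the mean of \<open>f\<close> at the
  number of successes in independent trials with success probabilities \<open>x i\<close>, as a
  polynomial in the \<open>x i\<close>.
  It dominates \<open>\<phi> (\<Sum> x\<^sub>i)\<close> pointwise (\<open>convex_le_bernoulli_mix\<close>). Being affine in each variable, it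
  commutes with expectations of independent variables (\<open>expectation_bernoulli_mix\<close>). Finally, it
  can, for convex \<open>f\<close>, only grow when two of its arguments are moved towards each other with
  their sum kept fixed, because the coefficient of \<open>x\<^sub>i x\<^sub>j\<close> is a mean of second differences of \<open>f\<close>; so at fixed sum it is
  largest when all arguments are equal (\<open>bernoulli_mix_le_const\<close>), where it is a binomial
  expectation.

  What is left is a fact on the binomial weights \<open>b k\<close>, namely
  \<open>(t - n p) \<Sum>\<^bsub>k\<ge>t\<^esub> (k - t + 1) b k \<le> t (1 - p) \<Sum>\<^bsub>k\<ge>t\<^esub> b k\<close>. The recursion
  \<open>(n - k) p b k = (k + 1) (1 - p) b (k + 1)\<close> gives, by telescoping,
  \<open>\<Sum>\<^bsub>k\<ge>t\<^esub> (k - t) (k - n p) b k = \<Sum>\<^bsub>k\<ge>t\<^esub> (n - k) p b k\<close>. With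
  \<open>(k - t) (t - n p) = (k - t) (k - n p) - (k - t)\<^sup>2\<close> the left-hand side of the
  inequality becomes \<open>\<Sum>\<^bsub>k\<ge>t\<^esub> (t - k p - (k - t)\<^sup>2) b k\<close>, and each factor in front of \<open>b k\<close>
  is at most \<open>t - t p\<close> because \<open>k \<ge> t\<close>.
\<close>

section \<open>Mixtures over independent Bernoulli trials\<close>

text \<open>
  Each summand is written as one product over the whole of \<open>I\<close>, so that the product
  rule for expectations of independent variables applies to it as it stands.
\<close>

definition bernoulli_mix :: "(nat \<Rightarrow> real) \<Rightarrow> ('i \<Rightarrow> real) \<Rightarrow> 'i set \<Rightarrow> real" where
  "bernoulli_mix f x I =
     (\<Sum>S\<in>Pow I. (\<Prod>i\<in>I. if i \<in> S then x i else 1 - x i) * f (card S))"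

lemma bernoulli_mix_empty [simp]: "bernoulli_mix f x {} = f 0"
  by (simp add: bernoulli_mix_def)

lemma bernoulli_mix_cong:
  "(\<And>i. i \<in> I \<Longrightarrow> x i = y i) \<Longrightarrow> bernoulli_mix f x I = bernoulli_mix f y I"
  unfolding bernoulli_mix_def
  by (intro sum.cong refl arg_cong2[where f = "(*)"] prod.cong) auto

text \<open>
  Conditioning on the outcome of trial \<open>i\<close>: a success shifts the count, hence \<open>f \<circ> Suc\<close>.
\<close>

lemma bernoulli_mix_insert:
  assumes "finite I" "i \<notin> I"
  shows "bernoulli_mix f x (insert i I) =
    x i * bernoulli_mix (f \<circ> Suc) x I + (1 - x i) * bernoulli_mix f x I"
proof -
  let ?w = "\<lambda>J S. \<Prod>j\<in>J. if j \<in> S then x j else 1 - x j"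
  have inj: "inj_on (insert i) (Pow I)"
    using assms(2) by (auto simp: inj_on_def insert_ident)
  have disj: "Pow I \<inter> insert i ` Pow I = {}"
    using assms(2) by auto
  have failure: "?w (insert i I) S * f (card S) = (1 - x i) * (?w I S * f (card S))"
    if "S \<in> Pow I" for S
  proof -
    have "i \<notin> S" using that assms(2) by auto
    then show ?thesis using assms by simp
  qed
  have success: "?w (insert i I) (insert i S) * f (card (insert i S)) =
      x i * (?w I S * (f \<circ> Suc) (card S))" if "S \<in> Pow I" for S
  proof -
    have "i \<notin> S" "finite S" using that assms by (auto intro: finite_subset)
    moreover have "?w I (insert i S) = ?w I S"
      using assms(2) by (intro prod.cong) auto
    ultimately show ?thesis using assms by simp
  qed
  have "bernoulli_mix f x (insert i I) =
      (\<Sum>S\<in>Pow I. ?w (insert i I) S * f (card S)) +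
      (\<Sum>S\<in>Pow I. ?w (insert i I) (insert i S) * f (card (insert i S)))"
    unfolding bernoulli_mix_def Pow_insert
    using assms(1) disj by (subst sum.union_disjoint) (auto simp: sum.reindex[OF inj])
  also have "\<dots> = (1 - x i) * bernoulli_mix f x I + x i * bernoulli_mix (f \<circ> Suc) x I"
    unfolding bernoulli_mix_def sum_distrib_left
    by (intro arg_cong2[where f = "(+)"] sum.cong refl failure success)
  finally show ?thesis by simp
qed

lemma bernoulli_mix_mono:
  assumes "\<And>i. i \<in> I \<Longrightarrow> 0 \<le> x i \<and> x i \<le> 1" "\<And>k. f k \<le> g k"
  shows "bernoulli_mix f x I \<le> bernoulli_mix g x I"
  unfolding bernoulli_mix_def
  by (intro sum_mono mult_left_mono assms prod_nonneg) (use assms(1) in auto)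

lemma bernoulli_mix_add:
  "bernoulli_mix (\<lambda>k. f k + g k) x I = bernoulli_mix f x I + bernoulli_mix g x I"
  by (simp add: bernoulli_mix_def sum.distrib ring_distribs)

lemma bernoulli_mix_const:
  assumes "finite I"
  shows "bernoulli_mix f (\<lambda>_. p) I =
    (\<Sum>k\<le>card I. real (card I choose k) * p ^ k * (1 - p) ^ (card I - k) * f k)"
proof -
  have weight: "(\<Prod>i\<in>I. if i \<in> S then p else 1 - p) = p ^ card S * (1 - p) ^ (card I - card S)"
    if "S \<in> Pow I" for S
  proof -
    have "I \<inter> S = S" "I \<inter> - S = I - S" "finite S"
      using that assms by (auto intro: finite_subset)
    then show ?thesis
      using that assms by (simp add: prod.If_cases card_Diff_subset)
  qed
  let ?h = "\<lambda>k. p ^ k * (1 - p) ^ (card I - k) * f k"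
  have "bernoulli_mix f (\<lambda>_. p) I = (\<Sum>S\<in>Pow I. ?h (card S))"
    unfolding bernoulli_mix_def by (intro sum.cong refl) (simp only: weight)
  also have "\<dots> = (\<Sum>k\<le>card I. real (card {S \<in> Pow I. card S = k}) * ?h k)"
    using assms by (intro sum_fun_comp) (auto intro: card_mono)
  also have "\<dots> = (\<Sum>k\<le>card I. real (card I choose k) * p ^ k * (1 - p) ^ (card I - k) * f k)"
    using n_subsets[OF assms] by (simp add: mult.assoc)
  finally show ?thesis .
qed

section \<open>Comparison with the binomial distribution\<close>

text \<open>
  A point \<open>x i\<close> of the unit interval is the mean of a Bernoulli variable; by Jensen's inequality,
  replacing it by this variable can only raise the mean of a convex function. The
  summand \<open>a\<close> carries the trials that have already been replaced.
\<close>

lemma convex_le_bernoulli_mix: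
  fixes \<phi> :: "real \<Rightarrow> real"
  assumes "finite I" "convex_on UNIV \<phi>" "\<And>i. i \<in> I \<Longrightarrow> 0 \<le> x i \<and> x i \<le> 1"
  shows "\<phi> (a + (\<Sum>i\<in>I. x i)) \<le> bernoulli_mix (\<lambda>k. \<phi> (a + real k)) x I"
  using assms(1,3)
proof (induction I arbitrary: a rule: finite_induct)
  case empty
  then show ?case by simp
next
  case (insert i I)
  let ?s = "\<Sum>i\<in>I. x i"
  have x: "0 \<le> x i" "x i \<le> 1" using insert.prems by auto
  have "\<phi> (a + (\<Sum>j\<in>insert i I. x j)) = \<phi> ((1 - x i) *\<^sub>R (a + ?s) + x i *\<^sub>R (a + 1 + ?s))"
    using insert.hyps by (simp add: algebra_simps)
  also have "\<dots> \<le> (1 - x i) * \<phi> (a + ?s) + x i * \<phi> (a + 1 + ?s)"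
    using convex_onD[OF assms(2)] x by simp
  also have "\<dots> \<le> (1 - x i) * bernoulli_mix (\<lambda>k. \<phi> (a + real k)) x I +
      x i * bernoulli_mix (\<lambda>k. \<phi> (a + 1 + real k)) x I"
    using insert.IH insert.prems x by (intro add_mono mult_left_mono) auto
  also have "\<dots> = bernoulli_mix (\<lambda>k. \<phi> (a + real k)) x (insert i I)"
    using insert.hyps by (simp add: bernoulli_mix_insert comp_def add_ac)
  finally show ?case .
qed

text \<open>
  As a function of two of its arguments the mixture is \<open>\<alpha> + \<beta> (x\<^sub>i + x\<^sub>j) + \<gamma> x\<^sub>i x\<^sub>j\<close>, where
  \<open>\<gamma>\<close> is a mean of second differences of \<open>f\<close>. With the sum kept fixed, it
  therefore grows with the product.
\<close>

lemma bernoulli_mix_two_le: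
  assumes "finite I" "i \<notin> I" "j \<notin> I" "i \<noteq> j"
    and "\<And>k. k \<in> I \<Longrightarrow> 0 \<le> x k \<and> x k \<le> 1"
    and "\<And>k. k \<in> I \<Longrightarrow> y k = x k"
    and "x i + x j = y i + y j" "x i * x j \<le> y i * y j"
    and convex: "\<And>k. 2 * f (Suc k) \<le> f k + f (Suc (Suc k))"
  shows "bernoulli_mix f x (insert i (insert j I)) \<le> bernoulli_mix f y (insert i (insert j I))"
proof -
  define A B C where "A = bernoulli_mix f x I" and "B = bernoulli_mix (f \<circ> Suc) x I"
    and "C = bernoulli_mix (f \<circ> Suc \<circ> Suc) x I"
  have y: "bernoulli_mix g y I = bernoulli_mix g x I" for g
    using assms(6) by (rule bernoulli_mix_cong)
  have "bernoulli_mix (\<lambda>k. f (Suc k) + f (Suc k)) x I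
      \<le> bernoulli_mix (\<lambda>k. f k + f (Suc (Suc k))) x I"
    by (rule bernoulli_mix_mono[OF assms(5) convex[unfolded mult_2]])
  then have "0 \<le> A - 2 * B + C"
    unfolding A_def B_def C_def bernoulli_mix_add by (simp add: comp_def)
  then have product: "x i * x j * (A - 2 * B + C) \<le> y i * y j * (A - 2 * B + C)"
    using assms(8) by (rule mult_right_mono[rotated])
  have polynomial: "bernoulli_mix f z (insert i (insert j I)) =
      A + (z i + z j) * (B - A) + z i * z j * (A - 2 * B + C)"
    if "z = x \<or> z = y" for z
    using that assms(1-4) y
    by (auto simp: bernoulli_mix_insert A_def B_def C_def algebra_simps)
  show ?thesis
    using product assms(7) by (simp add: polynomial)
qed

text \<open>
  If the arguments do not all equal their average \<open>p\<close>, one lies below \<open>p\<close> and one above. Moving the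
  first up to \<open>p\<close> and the second down by the same amount raises their product, and
  fewer arguments differ from \<open>p\<close> than before.
\<close>

lemma bernoulli_mix_le_const:
  assumes "finite I" "\<And>i. i \<in> I \<Longrightarrow> 0 \<le> x i \<and> x i \<le> 1"
    and "(\<Sum>i\<in>I. x i) = real (card I) * p"
    and convex: "\<And>k. 2 * f (Suc k) \<le> f k + f (Suc (Suc k))"
  shows "bernoulli_mix f x I \<le> bernoulli_mix f (\<lambda>_. p) I"
  using assms(2,3)
proof (induction "card {i \<in> I. x i \<noteq> p}" arbitrary: x rule: less_induct)
  case less
  show ?case
  proof (cases "\<forall>i\<in>I. x i = p")
    case True
    then show ?thesis by (simp cong: bernoulli_mix_cong)
  next
    case False
    have mean: "(\<Sum>i\<in>I. x i) = (\<Sum>i\<in>I. p)" using less.prems(2) by simp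
    obtain i where i: "i \<in> I" "x i < p"
    proof (rule ccontr)
      assume "\<not> thesis"
      then have "\<forall>i\<in>I. p \<le> x i" using that by force
      moreover from this False have "\<exists>i\<in>I. p < x i" by force
      ultimately have "(\<Sum>i\<in>I. p) < (\<Sum>i\<in>I. x i)"
        using assms(1) by (intro sum_strict_mono_ex1) auto
      then show False using mean by simp
    qed
    obtain j where j: "j \<in> I" "p < x j"
    proof (rule ccontr)
      assume "\<not> thesis"
      then have "\<forall>j\<in>I. x j \<le> p" using that by force
      then have "(\<Sum>i\<in>I. x i) < (\<Sum>i\<in>I. p)"
        using assms(1) i by (intro sum_strict_mono_ex1) auto
      then show False using mean by simp
    qed
    have ij: "i \<noteq> j" using i j by auto
    define J where "J = I - {i, j}"
    have J: "I = insert i (insert j J)" "finite J" "i \<notin> J" "j \<notin> J"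
      using i(1) j(1) assms(1) by (auto simp: J_def)
    define y where "y = x(i := p, j := x i + x j - p)"
    have y: "y i = p" "y j = x i + x j - p" "\<And>k. k \<in> J \<Longrightarrow> y k = x k"
      using ij J by (auto simp: y_def)
    have "0 \<le> (p - x i) * (x j - p)" using i j by simp
    then have product: "x i * x j \<le> y i * y j"
      by (simp add: y algebra_simps)
    have "bernoulli_mix f x I \<le> bernoulli_mix f y I"
      unfolding J(1)
      using less.prems(1) J ij y product convex
      by (intro bernoulli_mix_two_le) auto
    also have "\<dots> \<le> bernoulli_mix f (\<lambda>_. p) I"
    proof (rule less.hyps)
      have "{k \<in> I. y k \<noteq> p} \<subset> {k \<in> I. x k \<noteq> p}"
        using i j ij by (auto simp: y_def)
      then show "card {k \<in> I. y k \<noteq> p} < card {k \<in> I. x k \<noteq> p}"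
        using assms(1) by (intro psubset_card_mono) auto
      have "0 \<le> y i \<and> y i \<le> 1" "0 \<le> y j \<and> y j \<le> 1"
        using less.prems(1)[OF i(1)] less.prems(1)[OF j(1)] i(2) j(2) unfolding y by linarith+
      then show "0 \<le> y k \<and> y k \<le> 1" if "k \<in> I" for k
        using that less.prems(1) y(3) J(1) by (metis insertE)
      have "(\<Sum>k\<in>J. y k) = (\<Sum>k\<in>J. x k)" by (intro sum.cong) (auto simp: y)
      then have "(\<Sum>k\<in>I. y k) = (\<Sum>k\<in>I. x k)"
        using J ij y by simp
      then show "(\<Sum>k\<in>I. y k) = real (card I) * p" using less.prems(2) by simp
    qed
    finally show ?thesis .
  qed
qed

text \<open>
  The mixture is affine in each variable, so independence lets the expectation pass
  through every product.
\<close>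

lemma (in prob_space) expectation_bernoulli_mix:
  fixes X :: "'i \<Rightarrow> 'a \<Rightarrow> real"
  assumes "finite I" "indep_vars (\<lambda>_. borel) X I" "\<And>i. i \<in> I \<Longrightarrow> integrable M (X i)"
  shows "integrable M (\<lambda>\<omega>. bernoulli_mix f (\<lambda>i. X i \<omega>) I)"
    and "expectation (\<lambda>\<omega>. bernoulli_mix f (\<lambda>i. X i \<omega>) I) =
      bernoulli_mix f (\<lambda>i. expectation (X i)) I"
proof -
  define Y where "Y S i y = (if i \<in> S then y else 1 - y)" for S and i :: 'i and y :: real
  have indep: "indep_vars (\<lambda>_. borel) (\<lambda>i \<omega>. Y S i (X i \<omega>)) I" for S
    by (rule indep_vars_compose2[OF assms(2)]) (simp add: Y_def)
  have int: "integrable M (\<lambda>\<omega>. Y S i (X i \<omega>))" if "i \<in> I" for S i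
    using assms(3)[OF that] by (cases "i \<in> S") (simp_all add: Y_def)
  have exp: "expectation (\<lambda>\<omega>. Y S i (X i \<omega>)) = Y S i (expectation (X i))" if "i \<in> I" for S i
    using assms(3)[OF that] by (simp add: Y_def prob_space)
  have mix: "bernoulli_mix f x I = (\<Sum>S\<in>Pow I. (\<Prod>i\<in>I. Y S i (x i)) * f (card S))" for x
    by (simp add: bernoulli_mix_def Y_def)
  have prod_int: "integrable M (\<lambda>\<omega>. (\<Prod>i\<in>I. Y S i (X i \<omega>)))" for S
    by (rule indep_vars_integrable[OF assms(1) indep int])
  show "integrable M (\<lambda>\<omega>. bernoulli_mix f (\<lambda>i. X i \<omega>) I)"
    unfolding mix using prod_int by simp
  have "expectation (\<lambda>\<omega>. \<Prod>i\<in>I. Y S i (X i \<omega>)) = (\<Prod>i\<in>I. Y S i (expectation (X i)))" for S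
    using indep_vars_lebesgue_integral[OF assms(1) indep int] by (simp add: exp)
  then show "expectation (\<lambda>\<omega>. bernoulli_mix f (\<lambda>i. X i \<omega>) I) =
      bernoulli_mix f (\<lambda>i. expectation (X i)) I"
    unfolding mix using prod_int by simp
qed

text \<open>
  The Bernstein--Hoeffding method: any convex \<open>\<phi>\<close> that dominates the indicator of
  \<open>[t, \<infinity>)\<close> bounds the tail of the sum by a binomial mean.
\<close>

lemma (in prob_space) tail_le_binomial_convex:
  fixes \<phi> :: "real \<Rightarrow> real"
  assumes "finite I" "indep_vars (\<lambda>_. borel) X I"
    and bounds: "\<And>i. i \<in> I \<Longrightarrow> AE \<omega> in M. 0 \<le> X i \<omega> \<and> X i \<omega> \<le> 1"
    and mean: "(\<Sum>i\<in>I. expectation (X i)) = real (card I) * p"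
    and \<phi>: "convex_on UNIV \<phi>" "\<And>y. 0 \<le> \<phi> y" "\<And>y. t \<le> y \<Longrightarrow> 1 \<le> \<phi> y"
  shows "prob {\<omega> \<in> space M. t \<le> (\<Sum>i\<in>I. X i \<omega>)}
    \<le> (\<Sum>k\<le>card I. real (card I choose k) * p ^ k * (1 - p) ^ (card I - k) * \<phi> (real k))"
proof -
  let ?A = "{\<omega> \<in> space M. t \<le> (\<Sum>i\<in>I. X i \<omega>)}"
  let ?f = "\<lambda>k. \<phi> (real k)"
  have rv [measurable]: "random_variable borel (X i)" if "i \<in> I" for i
    using assms(2) that by (simp add: indep_vars_def)
  have int: "integrable M (X i)" if "i \<in> I" for i
    by (rule integrable_const_bound[where B = 1]) (use bounds[OF that] rv[OF that] in auto)
  have exp: "0 \<le> expectation (X i) \<and> expectation (X i) \<le> 1" if "i \<in> I" for i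
  proof
    show "0 \<le> expectation (X i)"
      using bounds[OF that] by (intro integral_nonneg_AE) auto
    show "expectation (X i) \<le> 1"
      using bounds[OF that] int[OF that] by (intro integral_le_const) auto
  qed
  have A: "?A \<in> events" by measurable
  have dominated: "AE \<omega> in M. indicator ?A \<omega> \<le> bernoulli_mix ?f (\<lambda>i. X i \<omega>) I"
  proof -
    have "AE \<omega> in M. \<forall>i\<in>I. 0 \<le> X i \<omega> \<and> X i \<omega> \<le> 1"
      using assms(1) bounds by (intro AE_finite_allI)
    then show ?thesis
    proof eventually_elim
      case (elim \<omega>)
      have "indicator ?A \<omega> \<le> \<phi> (\<Sum>i\<in>I. X i \<omega>)"
        using \<phi>(2,3) by (simp add: indicator_def)
      also have "\<dots> \<le> bernoulli_mix ?f (\<lambda>i. X i \<omega>) I"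
        using convex_le_bernoulli_mix[OF assms(1) \<phi>(1), of "\<lambda>i. X i \<omega>" 0] elim by simp
      finally show ?case .
    qed
  qed
  have convex: "2 * ?f (Suc k) \<le> ?f k + ?f (Suc (Suc k))" for k
  proof -
    have "(1 - 1/2) *\<^sub>R real k + (1/2) *\<^sub>R real (Suc (Suc k)) = real (Suc k)"
      by (simp add: field_simps)
    then show ?thesis
      using convex_onD[OF \<phi>(1), of "1/2" "real k" "real (Suc (Suc k))"] by simp
  qed
  have "prob ?A = expectation (indicator ?A)"
    using A by simp
  also have "\<dots> \<le> expectation (\<lambda>\<omega>. bernoulli_mix ?f (\<lambda>i. X i \<omega>) I)"
    using A dominated expectation_bernoulli_mix(1)[OF assms(1,2) int]
    by (intro integral_mono_AE) (auto simp: integrable_real_indicator emeasure_eq_measure)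
  also have "\<dots> = bernoulli_mix ?f (\<lambda>i. expectation (X i)) I"
    by (rule expectation_bernoulli_mix(2)[OF assms(1,2) int])
  also have "\<dots> \<le> bernoulli_mix ?f (\<lambda>_. p) I"
    using assms(1) exp mean convex by (rule bernoulli_mix_le_const)
  finally show ?thesis
    by (simp add: bernoulli_mix_const[OF assms(1)])
qed

section \<open>A binomial tail estimate\<close>

lemma binomial_weight_Suc:
  fixes p :: real
  assumes "k \<le> n"
  shows "(real n - real k) * p * (real (n choose k) * p ^ k * (1 - p) ^ (n - k)) =
    real (Suc k) * (1 - p) * (real (n choose Suc k) * p ^ Suc k * (1 - p) ^ (n - Suc k))"
proof (cases "k = n")
  case True
  then show ?thesis by simp
next
  case False
  then have nk: "n - k = Suc (n - Suc k)" using assms by simp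
  have "(n - k) * (n choose k) = Suc k * (n choose Suc k)"
    by (simp only: binomial_absorb_comp binomial_absorption)
  then have "real ((n - k) * (n choose k)) = real (Suc k * (n choose Suc k))"
    by (rule arg_cong)
  then have "(real n - real k) * real (n choose k) = real (Suc k) * real (n choose Suc k)"
    using assms by (simp only: of_nat_mult of_nat_diff)
  then have "(real n - real k) * real (n choose k) * (p ^ Suc k * (1 - p) ^ (n - k)) =
      real (Suc k) * real (n choose Suc k) * (p ^ Suc k * (1 - p) ^ (n - k))"
    by (rule arg_cong)
  then show ?thesis unfolding nk by (simp only: power_Suc mult_ac)
qed

text \<open>
  The sum on the left is the binomial mean of \<open>max 0 (k - t + 1)\<close>. Weighting the recursion
  by \<open>k - t\<close> makes it telescope without a boundary term at \<open>t\<close>.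
\<close>

lemma binomial_excess_le_tail:
  fixes p :: real
  assumes "0 \<le> p" "p \<le> 1" "t \<le> n"
  defines "b \<equiv> \<lambda>k. real (n choose k) * p ^ k * (1 - p) ^ (n - k)"
  shows "(real t - real n * p) * (\<Sum>k=t..n. (real k - real t + 1) * b k)
    \<le> (real t - real t * p) * (\<Sum>k=t..n. b k)"
proof -
  \<comment> \<open>\<open>u\<close> vanishes at \<open>t\<close> because of its first factor and at \<open>n + 1\<close> because of \<open>b\<close>.\<close>
  define u where "u k = (real k - real t) * (real k * (1 - p) * b k)" for k
  have step: "u (Suc k) - u k = ((real n - real k) * p - (real k - real t) * (real k - real n * p)) * b k"
    if "k \<in> {t..n}" for k
  proof -
    have "real (Suc k) * (1 - p) * b (Suc k) = (real n - real k) * p * b k"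
      unfolding b_def using that by (intro binomial_weight_Suc[symmetric]) simp
    then have "u (Suc k) = (real (Suc k) - real t) * ((real n - real k) * p * b k)"
      unfolding u_def by (rule arg_cong)
    then show ?thesis by (simp add: u_def algebra_simps)
  qed
  have telescope:
    "(\<Sum>k=t..n. ((real n - real k) * p - (real k - real t) * (real k - real n * p)) * b k) = 0"
    (is "?T = 0")
  proof -
    have "?T = (\<Sum>k=t..n. u (Suc k) - u k)"
      by (intro sum.cong refl) (simp add: step)
    also have "\<dots> = u (Suc n) - u t"
      using assms(3) by (intro sum_Suc_diff) simp
    finally show ?thesis by (simp add: u_def b_def)
  qed
  have "(real t - real n * p) * (\<Sum>k=t..n. (real k - real t + 1) * b k) =
      (\<Sum>k=t..n. (real t - real n * p) * ((real k - real t + 1) * b k)) + ?T"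
    by (simp add: telescope sum_distrib_left)
  also have "\<dots> = (\<Sum>k=t..n. (real t - real k * p - (real k - real t)\<^sup>2) * b k)"
    unfolding sum.distrib[symmetric]
    by (intro sum.cong refl) (simp add: algebra_simps power2_eq_square)
  also have "\<dots> \<le> (\<Sum>k=t..n. (real t - real t * p) * b k)"
  proof (intro sum_mono mult_right_mono)
    fix k assume "k \<in> {t..n}"
    then have "real t * p \<le> real k * p"
      using assms(1) by (intro mult_right_mono) auto
    then show "real t - real k * p - (real k - real t)\<^sup>2 \<le> real t - real t * p"
      using zero_le_power2[of "real k - real t"] by linarith
  next
    show "0 \<le> b k" for k using assms(1,2) by (simp add: b_def)
  qed
  finally show ?thesis by (simp add: sum_distrib_left)
qed

section \<open>The tail bound\<close>

theorem theorem1p8: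
  fixes M :: "'a measure" and X :: "nat \<Rightarrow> 'a \<Rightarrow> real"
    and n t :: nat and p :: real
  assumes "prob_space M"
    and "n > 0"
    and "prob_space.indep_vars M (\<lambda>_. borel) X {1..n}"
    and "\<And>i. i \<in> {1..n} \<Longrightarrow> AE \<omega> in M. 0 \<le> X i \<omega> \<and> X i \<omega> \<le> 1"
    and "p = (1 / real n) * (\<Sum>i=1..n. integral\<^sup>L M (X i))"
    and "t > 0"
    and "real n * p < real t" and "t < n"
  shows "measure M {\<omega> \<in> space M. (\<Sum>i=1..n. X i \<omega>) \<ge> real t}
      \<le> (real t - real t * p) / (real t - real n * p)
          * measure_pmf.prob (binomial_pmf n p) {B. B \<ge> t}"
proof -
  interpret prob_space M by fact
  define b where "b k = real (n choose k) * p ^ k * (1 - p) ^ (n - k)" for k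
  define \<phi> where "\<phi> y = max 0 (y - real t + 1)" for y :: real
  have "0 \<le> (\<Sum>i=1..n. expectation (X i))"
    using assms(4) by (intro sum_nonneg integral_nonneg_AE) auto
  then have "0 \<le> p" by (simp add: assms(5))
  moreover have "real n * p < real n * 1" using assms(7,8) by linarith
  then have "p < 1" using assms(2) by simp
  ultimately have p: "0 \<le> p" "p \<le> 1" "p \<in> {0..1}" by auto

  have "convex_on UNIV \<phi>"
  proof (rule convex_on_linorderI)
    fix s x y :: real assume s: "0 < s" "s < 1"
    have "0 \<le> (1 - s) * \<phi> x" "0 \<le> s * \<phi> y" using s by (auto simp: \<phi>_def)
    moreover have "(1 - s) * (x - real t + 1) \<le> (1 - s) * \<phi> x" "s * (y - real t + 1) \<le> s * \<phi> y"
      using s by (auto simp: \<phi>_def)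
    moreover have "(1 - s) *\<^sub>R x + s *\<^sub>R y - real t + 1 =
        (1 - s) * (x - real t + 1) + s * (y - real t + 1)" by (simp add: algebra_simps)
    ultimately show "\<phi> ((1 - s) *\<^sub>R x + s *\<^sub>R y) \<le> (1 - s) * \<phi> x + s * \<phi> y"
      unfolding \<phi>_def[of "(1 - s) *\<^sub>R x + s *\<^sub>R y"] by linarith
  qed simp
  moreover have "(\<Sum>i\<in>{1..n}. expectation (X i)) = real (card {1..n}) * p"
    using assms(2,5) by simp
  ultimately have "prob {\<omega> \<in> space M. real t \<le> (\<Sum>i=1..n. X i \<omega>)}
      \<le> (\<Sum>k\<le>card {1..n}. real (card {1..n} choose k) * p ^ k * (1 - p) ^ (card {1..n} - k)
            * \<phi> (real k))"
    using assms(3,4) by (intro tail_le_binomial_convex) (simp_all, simp_all add: \<phi>_def)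
  also have "\<dots> = (\<Sum>k\<le>n. b k * \<phi> (real k))"
    by (simp add: b_def)
  also have "\<dots> = (\<Sum>k=t..n. (real k - real t + 1) * b k)"
    by (rule sum.mono_neutral_cong_right) (auto simp: \<phi>_def)
  also have "\<dots> \<le> (real t - real t * p) / (real t - real n * p) * (\<Sum>k=t..n. b k)"
    using binomial_excess_le_tail[OF p(1,2), of t n] assms(7,8)
    by (simp add: b_def field_simps)
  also have "(\<Sum>k=t..n. b k) = measure_pmf.prob (binomial_pmf n p) {t..n}"
    using p(1,2) by (simp add: measure_measure_pmf_finite b_def)
  also have "\<dots> = measure_pmf.prob (binomial_pmf n p) {B. B \<ge> t}"
    by (rule measure_prob_cong_0) (use p in \<open>auto simp: b_def\<close>)
  finally show ?thesis .
qed

end
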